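(* Let $\{P_\theta:\theta\in\Theta\}$ be a statistical model for a random variable $Y$ taking values in $\mathcal{Y}$, let $\mathcal{A}$ be a set of actions, and let $L:\Theta\times\mathcal{A}\to\mathbb{R}$ be a loss function satisfying the no-sure-gain condition: $\sup_{\theta\in\Theta}L(\theta,a)\ge 0$ for every $a\in\mathcal{A}$. Let $\mathcal{S}=\{S_\theta:\theta\in\Theta\}$ be an e-variable collection, let $\delta:\mathcal{Y}\to\mathcal{A}$ be a decision rule, and let $\bar P(\theta\mid y)=1/S_\theta(y)$, $\bar R(y,a)=\sup_{\theta\in\Theta}\bar P(\theta\mid y)\,L(\theta,a)$ and $\bar R(\delta)=\bar R(Y,\delta(Y))$ be the associated e-posterior and e-posterior risk bounds. Then: (A) For all $\theta\in\Theta$, $$\mathbf{E}_{Y\sim P_\theta}\left[\frac{L(\theta,\delta(Y))}{\bar R(\delta)}\right]\le 1,$$ with the convention $0/0:=0$. (B) In particular, for every set $\mathcal{U}$, every function $b:\mathcal{Y}\times\mathcal{U}\times\Theta\times\mathcal{A}\to\mathbb{R}^+$, every $\theta\in\Theta$, every random variable $U$ taking values in $\mathcal{U}$ and every distribution $P'_\theta$ for $(Y,U)$ whose marginal on $Y$ coincides with $P_\theta$, $$\mathbf{E}_{(Y,U)\sim P'_\theta}\left[b(Y,U,\theta,\delta(Y))\cdot L(\theta,\delta(Y))\right]\le\sup_{(y,u,\theta')\in\mathcal{Y}\times\mathcal{U}\times\Theta} b(y,u,\theta',\delta(y))\cdot\bar R(y,\delta(y)).$$ (C) Moreover, for any e-collection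 $\mathcal{S}$, any e-posterior minimax decision rule $\delta^{\mathrm{mm}}$ relative to $\mathcal{S}$ and $L$, i.e. any rule $\delta^{\mathrm{mm}}:\mathcal{Y}\to\mathcal{A}$ satisfying $$\sup_{\theta\in\Theta}\bar P(\theta\mid y)\,L(\theta,\delta^{\mathrm{mm}}(y))=\min_{a\in\mathcal{A}}\sup_{\theta\in\Theta}\bar P(\theta\mid y)\,L(\theta,a)\quad\text{for all }y\in\mathcal{Y},$$ dominates every decision rule $\delta$ in the sense that for all $y\in\mathcal{Y}$: $\bar R(y,\delta^{\mathrm{mm}}(y))\le\bar R(y,\delta(y))$.
   Context: An e-variable relative to $\theta$ is a nonnegative statistic $S_\theta=S_\theta(Y)$ (a function of the data $Y$) with $\mathbf{E}_{Y\sim P_\theta}[S_\theta]\le 1$. An e-(variable) collection for the model is a family $\mathcal{S}=\{S_\theta:\theta\in\Theta\}$ in which each $S_\theta$ is an e-variable relative to $\theta$. The e-posterior is $\bar P(\theta\mid y):=1/S_\theta(y)$ with $1/0:=\infty$. In products, $\infty\cdot c:=0$ if $c=0$ and $\infty\cdot c:=\infty$ if $c>0$; for $c<0$, $\infty\cdot c:=-\infty$. Also, $c/\infty:=0$ for real $c$, and $c/0:=-\infty$ for $c<0$. $\mathbb{R}^+$ denotes the positive reals. $\bar R(\delta)$ is regarded as a random variable (a function of $Y$); the functions whose expectations are taken are assumed measurable.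
   Formalization: (A) and (B) additionally assume: at every y where L(θ,δ(y))<0 for all θ, the e-posterior is bounded over θ; without it they can fail when the supremum 0 in no-sure-gain is not attained (e.g. L(n)=-1/n, S_1=1, S_n=2/n). *)

theory Defs
  imports "HOL-Probability.Probability"
begin

text \<open>
  The measurable space \<open>M\<close> carries the data: the random variable \<open>Y\<close> is the
  identity on \<open>space M\<close>, and \<open>P \<theta>\<close> is its distribution.
\<close>

definition statistical_model :: "'t set \<Rightarrow> 'y measure \<Rightarrow> ('t \<Rightarrow> 'y measure) \<Rightarrow> bool" where
  "statistical_model \<Theta> M P \<longleftrightarrow> (\<forall>\<theta>\<in>\<Theta>. prob_space (P \<theta>) \<and> sets (P \<theta>) = sets M)"

text \<open>
  The expectation is \<open>E[f\<^sup>+] - E[f\<^sup>-]\<close> (\<^const>\<open>e2ennreal\<close> sends negative numbers to 0).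
  Unlike \<^const>\<open>lebesgue_integral\<close> it does not default to 0 for functions that are not
  integrable. Since \<open>\<infinity> - \<infinity> = \<infinity>\<close> in \<^typ>\<open>ereal\<close>, a finite upper bound on it also asserts
  that the expectation is well defined.
\<close>

definition expect :: "'x measure \<Rightarrow> ('x \<Rightarrow> ereal) \<Rightarrow> ereal" where
  "expect Q f = enn2ereal (\<integral>\<^sup>+ x. e2ennreal (f x) \<partial>Q) - enn2ereal (\<integral>\<^sup>+ x. e2ennreal (- f x) \<partial>Q)"

definition e_variable :: "'y measure \<Rightarrow> ('y \<Rightarrow> real) \<Rightarrow> bool" where
  "e_variable Q s \<longleftrightarrow>
     s \<in> borel_measurable Q \<and> (\<forall>y\<in>space Q. 0 \<le> s y) \<and> expect Q (\<lambda>y. ereal (s y)) \<le> 1"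

definition e_collection :: "'t set \<Rightarrow> ('t \<Rightarrow> 'y measure) \<Rightarrow> ('t \<Rightarrow> 'y \<Rightarrow> real) \<Rightarrow> bool" where
  "e_collection \<Theta> P S \<longleftrightarrow> (\<forall>\<theta>\<in>\<Theta>. e_variable (P \<theta>) (S \<theta>))"

definition no_sure_gain :: "'t set \<Rightarrow> 'a set \<Rightarrow> ('t \<Rightarrow> 'a \<Rightarrow> real) \<Rightarrow> bool" where
  "no_sure_gain \<Theta> A L \<longleftrightarrow> (\<forall>a\<in>A. (SUP \<theta>\<in>\<Theta>. ereal (L \<theta> a)) \<ge> 0)"

text \<open>
  The \<^typ>\<open>ereal\<close> operations satisfy \<open>1 / 0 = \<infinity>\<close>, \<open>\<infinity> * 0 = 0\<close>, \<open>\<infinity> * c = \<infinity>\<close> and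
  \<open>\<infinity> * (- c) = - \<infinity>\<close> for \<open>c > 0\<close>, \<open>c / \<infinity> = 0\<close>, \<open>0 / 0 = 0\<close>, and \<open>c / 0 = - \<infinity>\<close> for \<open>c < 0\<close>.
\<close>

definition e_posterior :: "('t \<Rightarrow> 'y \<Rightarrow> real) \<Rightarrow> 't \<Rightarrow> 'y \<Rightarrow> ereal" where
  "e_posterior S \<theta> y = 1 / ereal (S \<theta> y)"

definition e_risk ::
  "'t set \<Rightarrow> ('t \<Rightarrow> 'a \<Rightarrow> real) \<Rightarrow> ('t \<Rightarrow> 'y \<Rightarrow> real) \<Rightarrow> 'y \<Rightarrow> 'a \<Rightarrow> ereal" where
  "e_risk \<Theta> L S y a = (SUP \<theta>\<in>\<Theta>. e_posterior S \<theta> y * ereal (L \<theta> a))"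

text \<open>The infimum is a minimum, attained at \<open>\<delta> y\<close>, since \<open>\<delta>\<close> takes its values in \<open>A\<close>.\<close>

definition e_minimax ::
  "'t set \<Rightarrow> 'y measure \<Rightarrow> 'a set \<Rightarrow> ('t \<Rightarrow> 'a \<Rightarrow> real) \<Rightarrow> ('t \<Rightarrow> 'y \<Rightarrow> real) \<Rightarrow> ('y \<Rightarrow> 'a) \<Rightarrow> bool" where
  "e_minimax \<Theta> M A L S \<delta> \<longleftrightarrow>
     \<delta> \<in> space M \<rightarrow> A \<and>
     (\<forall>y\<in>space M. e_risk \<Theta> L S y (\<delta> y) = (INF a\<in>A. e_risk \<Theta> L S y a))"

text \<open>
  \<^const>\<open>no_sure_gain\<close> allows an action with \<open>L \<theta> a < 0\<close> for every \<open>\<theta>\<close> if the supremum is an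
  unattained 0. If moreover the e-posterior is unbounded, the risk bound can be negative and
  dividing by it reverses inequalities: for \<open>\<theta> = 1, 2, \<dots>\<close> with \<open>L \<theta> a = -1/\<theta>\<close>,
  \<open>S 1 y = 1\<close> and \<open>S \<theta> y = 2/\<theta>\<close> for \<open>\<theta> \<ge> 2\<close>, the risk bound is \<open>-1/2\<close> and the ratio of loss
  to risk bound at \<open>\<theta> = 1\<close> is 2. The next condition excludes just this combination; it
  holds trivially if for every action some \<open>\<theta>\<close> has nonnegative loss, in particular
  under no sure gain with finite \<open>\<Theta>\<close>.
\<close>

definition unattained_bounded ::
  "'t set \<Rightarrow> 'y measure \<Rightarrow> ('t \<Rightarrow> 'a \<Rightarrow> real) \<Rightarrow> ('t \<Rightarrow> 'y \<Rightarrow> real) \<Rightarrow> ('y \<Rightarrow> 'a) \<Rightarrow> bool" where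
  "unattained_bounded \<Theta> M L S \<delta> \<longleftrightarrow>
     (\<forall>y\<in>space M. (\<forall>\<theta>\<in>\<Theta>. L \<theta> (\<delta> y) < 0) \<longrightarrow> (SUP \<theta>\<in>\<Theta>. e_posterior S \<theta> y) < \<infinity>)"

end

theory Submission
  imports Defs
begin

text \<open>
  Write \<open>R y\<close> for the risk bound of the action \<open>\<delta> y\<close>. It is a supremum that includes the
  term \<open>L \<theta> (\<delta> y) / S \<theta> y\<close>, so the loss satisfies \<open>L \<theta> (\<delta> y) \<le> R y * S \<theta> y\<close> wherever \<open>R y\<close>
  is finite (\<open>loss_le_e_risk_times\<close>): the e-variable itself is the factor by which the
  loss can exceed its risk bound. No sure gain, together with a bounded e-posterior
  where all losses are negative, makes \<open>R y\<close> nonnegative (\<open>e_risk_nonneg\<close>), so that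
  dividing by \<open>R y\<close> keeps the direction of the inequality (\<open>loss_ratio_le_e_variable\<close>).

  In part (A) the ratio of loss to risk bound is therefore pointwise at most the e-variable
  \<open>S \<theta>\<close>, whose expectation is at most 1. In part (B), let \<open>c\<close> be the supremum of \<open>b * R\<close>.
  It is nonnegative, and if it is finite then \<open>b * L \<le> b * R * S \<le> c * S\<close> pointwise, so the
  expectation is at most \<open>c\<close>; this holds under any joint distribution with the right
  marginal, because \<open>S \<theta>\<close> depends on \<open>y\<close> alone. Both parts end with the same
  bound \<open>expect_le_scaled_e_variable\<close>. Part (C) is immediate, as a minimax action attains the
  infimum over all actions.
\<close>

section \<open>Expectations dominated by an e-variable\<close>

lemma expect_le_nn_integral:
  "expect Q f \<le> enn2ereal (\<integral>\<^sup>+ x. e2ennreal (f x) \<partial>Q)"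
  unfolding expect_def by (simp add: ereal_diff_le_self)

lemma expect_nonneg_eq:
  assumes "\<And>x. x \<in> space Q \<Longrightarrow> 0 \<le> f x"
  shows "expect Q f = enn2ereal (\<integral>\<^sup>+ x. e2ennreal (f x) \<partial>Q)"
proof -
  have "(\<integral>\<^sup>+ x. e2ennreal (- f x) \<partial>Q) = (\<integral>\<^sup>+ x. 0 \<partial>Q)"
    by (rule nn_integral_cong) (use assms in \<open>simp add: e2ennreal_neg\<close>)
  then show ?thesis
    unfolding expect_def by (simp add: zero_ennreal.rep_eq)
qed

lemma nn_integral_e_variable_le_1:
  assumes "e_variable Q s"
  shows "(\<integral>\<^sup>+ x. ennreal (s x) \<partial>Q) \<le> 1"
proof -
  have "enn2ereal (\<integral>\<^sup>+ x. e2ennreal (ereal (s x)) \<partial>Q) \<le> 1"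
    using assms expect_nonneg_eq[of Q "\<lambda>x. ereal (s x)"] by (simp add: e_variable_def)
  then show ?thesis
    by (simp add: less_eq_ennreal.rep_eq one_ennreal.rep_eq ennreal.abs_eq e2ennreal_ereal)
qed

text \<open>
  Discarding the negative part can only increase the expectation, and the positive part of \<open>f\<close>
  is dominated by the nonnegative function \<open>c * s\<close>.
\<close>

lemma expect_le_scaled_e_variable:
  assumes s: "e_variable Q s" and c: "0 \<le> c"
    and f: "\<And>x. x \<in> space Q \<Longrightarrow> f x \<le> ereal (c * s x)"
  shows "expect Q f \<le> ereal c"
proof -
  have meas: "s \<in> borel_measurable Q"
    using s by (simp add: e_variable_def)
  have "(\<integral>\<^sup>+ x. e2ennreal (f x) \<partial>Q) \<le> (\<integral>\<^sup>+ x. ennreal c * ennreal (s x) \<partial>Q)"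
  proof (rule nn_integral_mono)
    fix x assume "x \<in> space Q"
    from e2ennreal_mono[OF f[OF this]]
    show "e2ennreal (f x) \<le> ennreal c * ennreal (s x)"
      using c by (simp add: ennreal_mult' e2ennreal_ereal)
  qed
  also have "\<dots> = ennreal c * (\<integral>\<^sup>+ x. ennreal (s x) \<partial>Q)"
    using meas by (intro nn_integral_cmult) simp
  also have "\<dots> \<le> ennreal c * 1"
    by (intro mult_left_mono nn_integral_e_variable_le_1[OF s]) simp
  finally have "enn2ereal (\<integral>\<^sup>+ x. e2ennreal (f x) \<partial>Q) \<le> ereal c"
    using c by (simp add: less_eq_ennreal.rep_eq enn2ereal_ennreal)
  then show ?thesis
    using expect_le_nn_integral order_trans by blast
qed

lemma e_variable_distr:
  assumes g: "g \<in> measurable Q M" and s: "e_variable (distr Q M g) s"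
  shows "e_variable Q (\<lambda>x. s (g x))"
proof -
  have meas: "s \<in> borel_measurable M" and nonneg: "\<And>y. y \<in> space M \<Longrightarrow> 0 \<le> s y"
    using s by (simp_all add: e_variable_def)
  have pos: "0 \<le> s (g x)" if "x \<in> space Q" for x
    using nonneg measurable_space[OF g that] by simp
  have "(\<integral>\<^sup>+ x. ennreal (s (g x)) \<partial>Q) \<le> 1"
    using nn_integral_e_variable_le_1[OF s] g meas by (simp add: nn_integral_distr)
  then have "expect Q (\<lambda>x. ereal (s (g x))) \<le> 1"
    using expect_nonneg_eq[of Q "\<lambda>x. ereal (s (g x))"] pos
    by (simp add: less_eq_ennreal.rep_eq one_ennreal.rep_eq e2ennreal_ereal)
  then show ?thesis
    using measurable_compose[OF g meas] pos by (simp add: e_variable_def)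
qed

section \<open>Nonnegativity of the risk bound\<close>

lemma e_posterior_nonneg:
  assumes "0 \<le> S \<theta> y"
  shows "0 \<le> e_posterior S \<theta> y"
  using assms unfolding e_posterior_def by (simp add: zero_le_divide_ereal)

text \<open>
  A parameter with nonnegative loss contributes a nonnegative term. If all losses are negative,
  they still come arbitrarily close to 0, and a bounded e-posterior keeps the products close
  to 0 as well.
\<close>

lemma e_risk_nonneg:
  assumes S: "\<And>\<theta>. \<theta> \<in> \<Theta> \<Longrightarrow> 0 \<le> S \<theta> y"
    and gain: "0 \<le> (SUP \<theta>\<in>\<Theta>. ereal (L \<theta> a))"
    and bounded: "(\<forall>\<theta>\<in>\<Theta>. L \<theta> a < 0) \<Longrightarrow> (SUP \<theta>\<in>\<Theta>. e_posterior S \<theta> y) < \<infinity>"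
  shows "0 \<le> e_risk \<Theta> L S y a"
proof (cases "\<forall>\<theta>\<in>\<Theta>. L \<theta> a < 0")
  case False
  then obtain \<theta> where \<theta>: "\<theta> \<in> \<Theta>" "0 \<le> L \<theta> a"
    by force
  have "0 \<le> e_posterior S \<theta> y * ereal (L \<theta> a)"
    using \<theta> by (simp add: e_posterior_nonneg S)
  also have "\<dots> \<le> e_risk \<Theta> L S y a"
    unfolding e_risk_def using \<theta>(1) by (rule SUP_upper)
  finally show ?thesis .
next
  case True
  define B where "B = (SUP \<theta>\<in>\<Theta>. e_posterior S \<theta> y)"
  have upper: "e_posterior S \<theta> y \<le> B" if "\<theta> \<in> \<Theta>" for \<theta>
    unfolding B_def using that by (rule SUP_upper)
  have "\<Theta> \<noteq> {}"
    using gain by (auto simp: bot_ereal_def)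
  then have "0 \<le> B"
    using upper e_posterior_nonneg S by (meson ex_in_conv order_trans)
  with bounded[OF True] obtain \<beta> where \<beta>: "B = ereal \<beta>" "0 \<le> \<beta>"
    by (cases B) (auto simp: B_def)
  show ?thesis
  proof (rule ereal_le_epsilon2)
    fix \<epsilon> :: real assume "0 < \<epsilon>"
    \<comment> \<open>The summand 1 keeps the tolerance well defined when \<open>\<beta> = 0\<close>.\<close>
    define \<eta> where "\<eta> = \<epsilon> / (\<beta> + 1)"
    have "0 < \<eta>"
      using \<open>0 < \<epsilon>\<close> \<beta> by (simp add: \<eta>_def)
    then have "ereal (- \<eta>) < 0"
      by simp
    then have "ereal (- \<eta>) < (SUP \<theta>\<in>\<Theta>. ereal (L \<theta> a))"
      using gain by (rule less_le_trans)
    then obtain \<theta> where \<theta>: "\<theta> \<in> \<Theta>" "- \<eta> < L \<theta> a"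
      by (auto simp: less_SUP_iff)
    obtain p where p: "e_posterior S \<theta> y = ereal p" "0 \<le> p" "p \<le> \<beta>"
      using upper[OF \<theta>(1)] e_posterior_nonneg[of S \<theta> y, OF S[OF \<theta>(1)]] \<beta>
      by (cases "e_posterior S \<theta> y") auto
    have "p * \<eta> \<le> (\<beta> + 1) * \<eta>"
      using p \<open>0 < \<eta>\<close> by (intro mult_right_mono) auto
    moreover have "p * - \<eta> \<le> p * L \<theta> a"
      using p \<theta> by (intro mult_left_mono) auto
    moreover have "(\<beta> + 1) * \<eta> = \<epsilon>"
      using \<beta> by (simp add: \<eta>_def)
    ultimately have "0 \<le> p * L \<theta> a + \<epsilon>"
      by simp
    then have "0 \<le> e_posterior S \<theta> y * ereal (L \<theta> a) + ereal \<epsilon>"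
      by (simp add: p)
    also have "\<dots> \<le> e_risk \<Theta> L S y a + ereal \<epsilon>"
      unfolding e_risk_def using \<theta>(1) by (intro add_right_mono SUP_upper)
    finally show "0 \<le> e_risk \<Theta> L S y a + ereal \<epsilon>" .
  qed
qed

section \<open>Loss against risk bound\<close>

text \<open>
  This is the term of the supremum for \<open>\<theta>\<close>, cleared of its denominator. When \<open>S \<theta> y = 0\<close>,
  a positive loss would make that term infinite, so the loss must be at most 0.
\<close>

lemma loss_le_e_risk_times:
  assumes \<theta>: "\<theta> \<in> \<Theta>" and S: "0 \<le> S \<theta> y" and r: "e_risk \<Theta> L S y a = ereal r"
  shows "L \<theta> a \<le> r * S \<theta> y"
proof -
  have le: "e_posterior S \<theta> y * ereal (L \<theta> a) \<le> ereal r"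
    unfolding r[symmetric] e_risk_def using \<theta> by (rule SUP_upper)
  show ?thesis
  proof (cases "S \<theta> y = 0")
    case True
    then have "\<infinity> * ereal (L \<theta> a) \<le> ereal r"
      using le by (simp add: e_posterior_def)
    with True show ?thesis
      by (cases "0 < L \<theta> a") auto
  next
    case False
    then have "L \<theta> a / S \<theta> y \<le> r"
      using le by (simp add: e_posterior_def one_ereal_def)
    then show ?thesis
      using False S by (simp add: pos_divide_le_eq)
  qed
qed

lemma loss_ratio_le_e_variable:
  assumes \<theta>: "\<theta> \<in> \<Theta>" and S: "0 \<le> S \<theta> y" and nonneg: "0 \<le> e_risk \<Theta> L S y a"
  shows "ereal (L \<theta> a) / e_risk \<Theta> L S y a \<le> ereal (S \<theta> y)"
proof (cases "e_risk \<Theta> L S y a")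
  case (real r)
  have le: "L \<theta> a \<le> r * S \<theta> y"
    using \<theta> S real by (rule loss_le_e_risk_times)
  show ?thesis
  proof (cases "r = 0")
    case True
    \<comment> \<open>The loss is at most 0, so the ratio is \<open>- \<infinity>\<close> or \<open>0 / 0 = 0\<close>.\<close>
    then show ?thesis
      using le S real by (cases "L \<theta> a = 0") (auto simp: divide_ereal_def)
  next
    case False
    then show ?thesis
      using le real nonneg by (simp add: pos_divide_le_eq mult.commute)
  qed
qed (use S nonneg in auto)

section \<open>Validity and minimax dominance\<close>

theorem proposition1:
  fixes \<Theta> :: "'t set" and M :: "'y measure" and P :: "'t \<Rightarrow> 'y measure"
    and A :: "'a set" and L :: "'t \<Rightarrow> 'a \<Rightarrow> real"
    and S :: "'t \<Rightarrow> 'y \<Rightarrow> real" and \<delta> :: "'y \<Rightarrow> 'a"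
  assumes "statistical_model \<Theta> M P"
    and "no_sure_gain \<Theta> A L"
    and "e_collection \<Theta> P S"
    and "\<delta> \<in> space M \<rightarrow> A"
  shows
    "(unattained_bounded \<Theta> M L S \<delta> \<longrightarrow>
       (\<forall>\<theta>\<in>\<Theta>. (\<lambda>y. ereal (L \<theta> (\<delta> y)) / e_risk \<Theta> L S y (\<delta> y)) \<in> borel_measurable M \<longrightarrow>
          expect (P \<theta>) (\<lambda>y. ereal (L \<theta> (\<delta> y)) / e_risk \<Theta> L S y (\<delta> y)) \<le> 1))
     \<and>
     (unattained_bounded \<Theta> M L S \<delta> \<longrightarrow>
       (\<forall>(N :: 'u measure) (b :: 'y \<Rightarrow> 'u \<Rightarrow> 't \<Rightarrow> 'a \<Rightarrow> real).
          (\<forall>y\<in>space M. \<forall>u\<in>space N. \<forall>\<theta>\<in>\<Theta>. \<forall>a\<in>A. b y u \<theta> a > 0) \<longrightarrow>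
          (\<forall>\<theta>\<in>\<Theta>. \<forall>P'.
             prob_space P' \<and> sets P' = sets (M \<Otimes>\<^sub>M N) \<and> distr P' M fst = P \<theta> \<and>
             (\<lambda>(y, u). b y u \<theta> (\<delta> y) * L \<theta> (\<delta> y)) \<in> borel_measurable (M \<Otimes>\<^sub>M N) \<longrightarrow>
             expect P' (\<lambda>(y, u). ereal (b y u \<theta> (\<delta> y) * L \<theta> (\<delta> y)))
               \<le> (SUP (y, u, \<theta>') \<in> space M \<times> space N \<times> \<Theta>.
                     ereal (b y u \<theta>' (\<delta> y)) * e_risk \<Theta> L S y (\<delta> y)))))
     \<and>
     (\<forall>S' \<delta>mm \<delta>'.
        e_collection \<Theta> P S' \<longrightarrow> e_minimax \<Theta> M A L S' \<delta>mm \<longrightarrow> \<delta>' \<in> space M \<rightarrow> A \<longrightarrow>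
        (\<forall>y\<in>space M. e_risk \<Theta> L S' y (\<delta>mm y) \<le> e_risk \<Theta> L S' y (\<delta>' y)))"
proof (intro conjI impI ballI allI)
  have S_nonneg: "0 \<le> S \<theta> y" if "\<theta> \<in> \<Theta>" "y \<in> space M" for \<theta> y
  proof -
    have "space (P \<theta>) = space M"
      using assms(1) that(1) by (intro sets_eq_imp_space_eq) (simp add: statistical_model_def)
    then show ?thesis
      using assms(3) that by (auto simp: e_collection_def e_variable_def)
  qed
  have R_nonneg: "0 \<le> e_risk \<Theta> L S y (\<delta> y)"
    if "unattained_bounded \<Theta> M L S \<delta>" "y \<in> space M" for y
  proof (rule e_risk_nonneg)
    show "0 \<le> (SUP \<theta>\<in>\<Theta>. ereal (L \<theta> (\<delta> y)))"
      using assms(2,4) that by (auto simp: no_sure_gain_def)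
    show "(SUP \<theta>\<in>\<Theta>. e_posterior S \<theta> y) < \<infinity>" if "\<forall>\<theta>\<in>\<Theta>. L \<theta> (\<delta> y) < 0"
      using \<open>unattained_bounded \<Theta> M L S \<delta>\<close> \<open>y \<in> space M\<close> that
      unfolding unattained_bounded_def by blast
  qed (use S_nonneg that in simp)
  {
    fix \<theta>
    assume bounded: "unattained_bounded \<Theta> M L S \<delta>" and \<theta>: "\<theta> \<in> \<Theta>"
    have sp: "space (P \<theta>) = space M"
      using assms(1) \<theta> by (intro sets_eq_imp_space_eq) (simp add: statistical_model_def)
    have "expect (P \<theta>) (\<lambda>y. ereal (L \<theta> (\<delta> y)) / e_risk \<Theta> L S y (\<delta> y)) \<le> ereal 1"
    proof (rule expect_le_scaled_e_variable)
      show "e_variable (P \<theta>) (S \<theta>)"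
        using assms(3) \<theta> by (simp add: e_collection_def)
      show "ereal (L \<theta> (\<delta> y)) / e_risk \<Theta> L S y (\<delta> y) \<le> ereal (1 * S \<theta> y)"
        if "y \<in> space (P \<theta>)" for y
        using loss_ratio_le_e_variable[of \<theta> \<Theta> S y L "\<delta> y"] \<theta> that sp S_nonneg R_nonneg[OF bounded]
        by simp
    qed simp
    then show "expect (P \<theta>) (\<lambda>y. ereal (L \<theta> (\<delta> y)) / e_risk \<Theta> L S y (\<delta> y)) \<le> 1"
      by (simp add: one_ereal_def)
  next
    fix N :: "'u measure" and b :: "'y \<Rightarrow> 'u \<Rightarrow> 't \<Rightarrow> 'a \<Rightarrow> real" and \<theta> P'
    assume bounded: "unattained_bounded \<Theta> M L S \<delta>"
      and b: "\<forall>y\<in>space M. \<forall>u\<in>space N. \<forall>\<theta>\<in>\<Theta>. \<forall>a\<in>A. b y u \<theta> a > 0"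
      and \<theta>: "\<theta> \<in> \<Theta>"
      and P': "prob_space P' \<and> sets P' = sets (M \<Otimes>\<^sub>M N) \<and> distr P' M fst = P \<theta> \<and>
             (\<lambda>(y, u). b y u \<theta> (\<delta> y) * L \<theta> (\<delta> y)) \<in> borel_measurable (M \<Otimes>\<^sub>M N)"
    have sets: "sets P' = sets (M \<Otimes>\<^sub>M N)" and marginal: "distr P' M fst = P \<theta>"
      using P' by simp_all
    have sp: "space P' = space M \<times> space N"
      using sets_eq_imp_space_eq[OF sets] by (simp add: space_pair_measure)
    define C where "C = (SUP (y, u, \<theta>') \<in> space M \<times> space N \<times> \<Theta>.
                     ereal (b y u \<theta>' (\<delta> y)) * e_risk \<Theta> L S y (\<delta> y))"
    have b_pos: "0 < b y u \<theta> (\<delta> y)" if "y \<in> space M" "u \<in> space N" for y u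
      using b \<theta> that funcset_mem[OF assms(4)] by blast
    have upper: "ereal (b y u \<theta> (\<delta> y)) * e_risk \<Theta> L S y (\<delta> y) \<le> C"
      if "y \<in> space M" "u \<in> space N" for y u
      unfolding C_def by (rule SUP_upper2[of "(y, u, \<theta>)"]) (use that \<theta> in auto)
    have "space P' \<noteq> {}"
      using P' prob_space.not_empty by blast
    then obtain y0 u0 where 0: "y0 \<in> space M" "u0 \<in> space N"
      using sp by auto
    have "0 \<le> ereal (b y0 u0 \<theta> (\<delta> y0)) * e_risk \<Theta> L S y0 (\<delta> y0)"
      using b_pos[OF 0] R_nonneg[OF bounded 0(1)] by simp
    also have "\<dots> \<le> C"
      using 0 by (rule upper)
    finally have "0 \<le> C" .
    have "expect P' (\<lambda>(y, u). ereal (b y u \<theta> (\<delta> y) * L \<theta> (\<delta> y))) \<le> C"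
    proof (cases C)
      case (real c)
      have "expect P' (\<lambda>(y, u). ereal (b y u \<theta> (\<delta> y) * L \<theta> (\<delta> y))) \<le> ereal c"
      proof (rule expect_le_scaled_e_variable)
        show "e_variable P' (\<lambda>x. S \<theta> (fst x))"
        proof (rule e_variable_distr[where g = fst and M = M and s = "S \<theta>"])
          show "fst \<in> measurable P' M"
            unfolding measurable_cong_sets[OF sets refl] by (rule measurable_fst)
          show "e_variable (distr P' M fst) (S \<theta>)"
            using assms(3) \<theta> by (simp add: marginal e_collection_def)
        qed
        show "0 \<le> c"
          using \<open>0 \<le> C\<close> real by simp
        fix x assume "x \<in> space P'"
        then obtain y u where x: "x = (y, u)" "y \<in> space M" "u \<in> space N"
          using sp by auto
        let ?\<beta> = "b y u \<theta> (\<delta> y)"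
        have \<beta>: "0 < ?\<beta>"
          using x b_pos by simp
        \<comment> \<open>A positive multiple of the risk bound is at most \<open>c\<close>, so the risk bound is finite.\<close>
        obtain r where r: "e_risk \<Theta> L S y (\<delta> y) = ereal r"
          using upper[OF x(2,3)] R_nonneg[OF bounded x(2)] real \<beta>
          by (cases "e_risk \<Theta> L S y (\<delta> y)") auto
        have "?\<beta> * L \<theta> (\<delta> y) \<le> ?\<beta> * (r * S \<theta> y)"
          using loss_le_e_risk_times[of \<theta> \<Theta> S y L "\<delta> y", OF \<theta> S_nonneg[OF \<theta> x(2)] r] \<beta>
          by simp
        also have "\<dots> = (?\<beta> * r) * S \<theta> y"
          by simp
        also have "\<dots> \<le> c * S \<theta> y"
          using upper[OF x(2,3)] r real S_nonneg[OF \<theta> x(2)] by (intro mult_right_mono) auto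
        finally show "(case x of (y, u) \<Rightarrow> ereal (b y u \<theta> (\<delta> y) * L \<theta> (\<delta> y)))
            \<le> ereal (c * S \<theta> (fst x))"
          using x by simp
      qed
      then show ?thesis
        using real by simp
    qed (use \<open>0 \<le> C\<close> in auto)
    then show "expect P' (\<lambda>(y, u). ereal (b y u \<theta> (\<delta> y) * L \<theta> (\<delta> y)))
               \<le> (SUP (y, u, \<theta>') \<in> space M \<times> space N \<times> \<Theta>.
                     ereal (b y u \<theta>' (\<delta> y)) * e_risk \<Theta> L S y (\<delta> y))"
      by (simp add: C_def)
  next
    fix S' \<delta>mm \<delta>' y
    assume "e_minimax \<Theta> M A L S' \<delta>mm" "\<delta>' \<in> space M \<rightarrow> A" "y \<in> space M"
    then show "e_risk \<Theta> L S' y (\<delta>mm y) \<le> e_risk \<Theta> L S' y (\<delta>' y)"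
      by (auto simp: e_minimax_def intro: INF_lower)
  }
qed

end
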